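(* Let $\alpha:\mathbb{R}^2\to\mathbb{R}^2$ be a non-isometric similarity that is not a dilation. Let $P,Q,R$ be non-collinear points, put $P'=\alpha(P)$, $Q'=\alpha(Q)$, $R'=\alpha(R)$, and suppose that the triangle $\triangle P'Q'R'$ is non-degenerate, that $\overleftrightarrow{PQ}\nparallel\overleftrightarrow{P'Q'}$, and that $\overleftrightarrow{QR}\nparallel\overleftrightarrow{Q'R'}$. Perform the following construction. (1) Let $m=\overleftrightarrow{PQ}$ and let $n$ be the line through $R$ parallel to $m$. (2) Let $m'=\overleftrightarrow{P'Q'}$ and let $n'$ be the line through $R'$ parallel to $m'$. (3) Let $D$ be the point $m\cap m'$ and $E$ the point $n\cap n'$. (4) Let $a=\overleftrightarrow{DE}$. (5) Repeat (1)--(4) with the roles of $P$ and $R$ interchanged (and correspondingly $P'$ and $R'$): let $F$ be the point $\overleftrightarrow{QR}\cap\overleftrightarrow{Q'R'}$, let $G$ be the intersection point of the line through $P$ parallel to $\overleftrightarrow{QR}$ with the line through $P'$ parallel to $\overleftrightarrow{Q'R'}$, and let $b=\overleftrightarrow{FG}$. Then the lines $a$ and $b$ meet in exactly one point $C$, and $C$ is the fixed point of $\alpha$.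
   Context: All points and lines are in the Euclidean plane $\mathbb{R}^2$; $PQ$ denotes the distance between points $P$ and $Q$, and $\overleftrightarrow{PQ}$ the line through distinct points $P,Q$. A similarity of ratio $r>0$ is a map $\alpha:\mathbb{R}^2\to\mathbb{R}^2$ such that for all points $P,Q$, with $P'=\alpha(P)$ and $Q'=\alpha(Q)$, one has $P'Q'=r\,PQ$. An isometry is a similarity of ratio $1$; a non-isometric similarity is a similarity of ratio $r\neq 1$. Every non-isometric similarity has a unique fixed point, called "the fixed point". The stretch $\xi_{C,r}$ about a point $C$ of ratio $r>0$ fixes $C$ and sends each $P\ne C$ to the unique point $P'$ on the ray $\overrightarrow{CP}$ with $CP'=r\,CP$. The halfturn $\varphi_C$ is the rotation about $C$ through $180^\circ$. A dilation about $C$ of ratio $r>0$ is a map equal to $\xi_{C,r}$ or to $\varphi_C\circ\xi_{C,r}$; a map is a dilation if it is a dilation about some $C$ of some ratio $r>0$. Two lines $l,m$ are parallel ($l\parallel m$) if $l=m$ or $l\cap m=\varnothing$. *)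

theory Defs
  imports "HOL-Analysis.Analysis"
begin

definition line :: "real^2 \<Rightarrow> real^2 \<Rightarrow> (real^2) set" where
  "line P Q = affine hull {P, Q}"

definition is_line :: "(real^2) set \<Rightarrow> bool" where
  "is_line l \<longleftrightarrow> (\<exists>P Q. P \<noteq> Q \<and> l = line P Q)"

definition parallel :: "(real^2) set \<Rightarrow> (real^2) set \<Rightarrow> bool" where
  "parallel l m \<longleftrightarrow> l = m \<or> l \<inter> m = {}"

text \<open>Well defined whenever \<^term>\<open>m\<close> is a line; see \<open>ex1_parallel_through\<close> below.\<close>

definition parallel_through :: "real^2 \<Rightarrow> (real^2) set \<Rightarrow> (real^2) set" where
  "parallel_through R m = (THE n. is_line n \<and> R \<in> n \<and> parallel n m)"

definition similarity :: "real \<Rightarrow> (real^2 \<Rightarrow> real^2) \<Rightarrow> bool" where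
  "similarity r \<alpha> \<longleftrightarrow> r > 0 \<and> (\<forall>P Q. dist (\<alpha> P) (\<alpha> Q) = r * dist P Q)"

definition non_isometric_similarity :: "(real^2 \<Rightarrow> real^2) \<Rightarrow> bool" where
  "non_isometric_similarity \<alpha> \<longleftrightarrow> (\<exists>r. r \<noteq> 1 \<and> similarity r \<alpha>)"

definition ray :: "real^2 \<Rightarrow> real^2 \<Rightarrow> (real^2) set" where
  "ray C P = {C + t *\<^sub>R (P - C) | t. t \<ge> 0}"

definition stretch :: "real^2 \<Rightarrow> real \<Rightarrow> real^2 \<Rightarrow> real^2" where
  "stretch C r P =
     (if P = C then C else (THE P'. P' \<in> ray C P \<and> dist C P' = r * dist C P))"

definition rotation :: "real^2 \<Rightarrow> real \<Rightarrow> real^2 \<Rightarrow> real^2" where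
  "rotation C \<theta> P = C + vector [cos \<theta> * (P - C) $ 1 - sin \<theta> * (P - C) $ 2,
                                sin \<theta> * (P - C) $ 1 + cos \<theta> * (P - C) $ 2]"

definition halfturn :: "real^2 \<Rightarrow> real^2 \<Rightarrow> real^2" where
  "halfturn C = rotation C pi"

definition dilation_about :: "real^2 \<Rightarrow> real \<Rightarrow> (real^2 \<Rightarrow> real^2) \<Rightarrow> bool" where
  "dilation_about C r f \<longleftrightarrow> r > 0 \<and> (f = stretch C r \<or> f = halfturn C \<circ> stretch C r)"

definition dilation :: "(real^2 \<Rightarrow> real^2) \<Rightarrow> bool" where
  "dilation f \<longleftrightarrow> (\<exists>C r. dilation_about C r f)"

lemma line_alt: "line P Q = {P + t *\<^sub>R (Q - P) | t. True}"
  by (simp add: line_def affine_hull_2_alt full_SetCompr_eq)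

lemma ex1_parallel_through:
  assumes "is_line m"
  shows "\<exists>!n. is_line n \<and> R \<in> n \<and> parallel n m"
proof -
  obtain A B where AB: "A \<noteq> B" "m = line A B"
    using assms by (auto simp: is_line_def)
  define u where "u = B - A"
  have u: "u \<noteq> 0" using AB by (simp add: u_def)
  have m: "m = {A + t *\<^sub>R u | t. True}" using AB by (simp add: line_alt u_def)
  define n where "n = {R + t *\<^sub>R u | t. True}"
  have ln: "is_line n"
    unfolding is_line_def n_def
    by (rule exI[of _ R], rule exI[of _ "R + u"]) (use u in \<open>simp add: line_alt\<close>)
  have Rn: "R \<in> n" unfolding n_def by (auto intro: exI[of _ 0])
  have par: "parallel n m"
  proof (cases "n \<inter> m = {}")
    case False
    then obtain s t where st: "R + s *\<^sub>R u = A + t *\<^sub>R u" by (auto simp: n_def m)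
    have R: "R = A + (t - s) *\<^sub>R u" using st by (simp add: algebra_simps)
    have "R + x *\<^sub>R u = A + (x + (t - s)) *\<^sub>R u" for x
      by (simp add: R algebra_simps)
    moreover have "A + x *\<^sub>R u = R + (x - (t - s)) *\<^sub>R u" for x
      by (simp add: R algebra_simps)
    ultimately have "n = m" unfolding n_def m by blast
    then show ?thesis by (simp add: parallel_def)
  qed (simp add: parallel_def)
  have "k = n" if k: "is_line k" "R \<in> k" "parallel k m" for k
  proof -
    obtain S T where ST: "S \<noteq> T" "k = line S T" using k by (auto simp: is_line_def)
    define v where "v = T - S"
    have v: "v \<noteq> 0" using ST by (simp add: v_def)
    obtain r where r: "R = S + r *\<^sub>R v" using k(2) ST by (auto simp: line_alt v_def)
    have kS: "k = {S + t *\<^sub>R v | t. True}" using ST by (simp add: line_alt v_def)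
    have "S + x *\<^sub>R v = R + (x - r) *\<^sub>R v" "R + x *\<^sub>R v = S + (x + r) *\<^sub>R v" for x
      by (simp_all add: r algebra_simps)
    then have kR: "k = {R + t *\<^sub>R v | t. True}" unfolding kS by blast
    have det: "v$1 * u$2 - v$2 * u$1 = 0"
    proof (rule ccontr)
      define d where "d = v$1 * u$2 - v$2 * u$1"
      assume "v$1 * u$2 - v$2 * u$1 \<noteq> 0"
      then have d: "d \<noteq> 0" by (simp add: d_def)
      define w where "w = A - R"
      define s where "s = (w$1 * u$2 - w$2 * u$1) / d"
      define t where "t = (w$1 * v$2 - w$2 * v$1) / d"
      have "d *\<^sub>R (s *\<^sub>R v) = d *\<^sub>R (w + t *\<^sub>R u)"
        using d by (simp add: vec_eq_iff forall_2 s_def t_def distrib_left)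
          (simp add: d_def algebra_simps)
      then have "s *\<^sub>R v = w + t *\<^sub>R u" using d by (rule scaleR_left_imp_eq[rotated])
      then have "R + s *\<^sub>R v = A + t *\<^sub>R u" by (simp add: w_def)
      then have "k \<inter> m \<noteq> {}" unfolding kR m by auto
      then have "k = m" using k(3) by (simp add: parallel_def)
      moreover have "A + 0 *\<^sub>R u \<in> m" "A + 1 *\<^sub>R u \<in> m" unfolding m by blast+
      ultimately have "A \<in> k" "A + u \<in> k" by simp_all
      then obtain x y where "A = R + x *\<^sub>R v" "A + u = R + y *\<^sub>R v"
        unfolding kR by blast
      then have "u = (y - x) *\<^sub>R v" by (simp add: algebra_simps)
      then show False using d by (simp add: d_def)
    qed
    have "\<exists>c. v = c *\<^sub>R u"
    proof (cases "u$1 = 0")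
      case True
      then have "u$2 \<noteq> 0" using u by (auto simp: vec_eq_iff forall_2)
      then have "v = (v$2 / u$2) *\<^sub>R u"
        using True det by (simp add: vec_eq_iff forall_2)
      then show ?thesis ..
    next
      case False
      then have "v = (v$1 / u$1) *\<^sub>R u"
        using det by (simp add: vec_eq_iff forall_2 field_simps)
      then show ?thesis ..
    qed
    then obtain c where c: "v = c *\<^sub>R u" ..
    with v have "c \<noteq> 0" by auto
    then have "R + x *\<^sub>R u = R + (x / c) *\<^sub>R v" "R + x *\<^sub>R v = R + (x * c) *\<^sub>R u" for x
      by (simp_all add: c)
    then show "k = n" unfolding kR n_def by blast
  qed
  with ln Rn par show ?thesis by blast
qed

lemma stretch_eq:
  assumes "r > 0"
  shows "stretch C r P = C + r *\<^sub>R (P - C)"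
proof (cases "P = C")
  case False
  have "(THE P'. P' \<in> ray C P \<and> dist C P' = r * dist C P) = C + r *\<^sub>R (P - C)"
  proof (rule the_equality)
    show "C + r *\<^sub>R (P - C) \<in> ray C P \<and> dist C (C + r *\<^sub>R (P - C)) = r * dist C P"
      using assms by (auto simp: ray_def dist_norm norm_minus_commute)
  next
    fix X assume X: "X \<in> ray C P \<and> dist C X = r * dist C P"
    then obtain t where t: "t \<ge> 0" "X = C + t *\<^sub>R (P - C)" by (auto simp: ray_def)
    have "t * norm (P - C) = r * norm (P - C)"
      using X t by (simp add: dist_norm norm_minus_commute)
    then show "X = C + r *\<^sub>R (P - C)" using False t by simp
  qed
  then show ?thesis using False by (simp add: stretch_def)
qed (simp add: stretch_def)

lemma halfturn_eq: "halfturn C P = 2 *\<^sub>R C - P"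
  by (simp add: halfturn_def rotation_def vec_eq_iff forall_2 vector_2)

end

theory Submission
  imports Defs
begin

text \<open>
  A similarity \<open>\<alpha>\<close> of ratio \<open>r \<noteq> 1\<close> is affine, with a linear part \<open>A\<close> that scales all norms by \<open>r\<close>.
  Hence \<open>A\<close> has no nonzero fixed vector, \<open>A - id\<close> is bijective, and \<open>\<alpha>\<close> has exactly one fixed
  point \<open>C\<close> (lemma \<open>non_isometric_similarity_affine\<close>), so that \<open>\<alpha> X = C + A (X - C)\<close>.

  The key fact is that, for a direction \<open>u\<close> not parallel to \<open>A u\<close>, the points in which the lines of
  direction \<open>u\<close> meet their images all lie on a single line through \<open>C\<close>. Indeed, let \<open>U\<close> be the
  vector with \<open>A U - U = u\<close>. The vectors \<open>U\<close> and \<open>u\<close> form a basis, so any point \<open>S\<close> can be written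
  as \<open>S = C + c U + d u\<close>. Since \<open>A U = U + u\<close>, the point \<open>C + c A U = C + c U + c u\<close> is on the line
  through \<open>S\<close> of direction \<open>u\<close>; applying \<open>A\<close> to \<open>c U + d u\<close> shows that it is on the image of that
  line as well. So the intersection point is \<open>C + c A U\<close>, and it runs through the line
  of direction \<open>A U\<close> at \<open>C\<close>, injectively in the parameter \<open>c\<close> of the line
  (lemmas \<open>line_Int_image_line\<close> and \<open>construction_line\<close>).

  Thus \<open>a\<close> and \<open>b\<close> are the lines through \<open>C\<close> with directions \<open>A U\<close> and \<open>A V\<close>, where \<open>U\<close> and \<open>V\<close>
  belong to the directions \<open>Q - P\<close> and \<open>R - Q\<close>. These two directions are independent, and the
  linear bijection \<open>A \<circ> (A - id)\<^sup>-\<^sup>1\<close> that takes them to \<open>A U\<close> and \<open>A V\<close> preserves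
  independence, so \<open>a\<close> and \<open>b\<close> meet in \<open>C\<close> only.
\<close>

section \<open>Independent directions and lines in the plane\<close>

text \<open>
  Linear independence of two vectors is phrased as non-collinearity with the origin, which is how
  it arises from the triangle.
\<close>

lemma noncollinear_0_iff:
  fixes u v :: "'a::real_vector"
  shows "\<not> collinear {0, u, v} \<longleftrightarrow> (\<forall>a b. a *\<^sub>R u = b *\<^sub>R v \<longrightarrow> a = 0 \<and> b = 0)"
proof
  assume nc: "\<not> collinear {0, u, v}"
  show "\<forall>a b. a *\<^sub>R u = b *\<^sub>R v \<longrightarrow> a = 0 \<and> b = 0"
  proof (intro allI impI)
    fix a b assume eq: "a *\<^sub>R u = b *\<^sub>R v"
    have b: "b = 0"
    proof (rule ccontr)
      assume "b \<noteq> 0"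
      have "(a / b) *\<^sub>R u = (1 / b) *\<^sub>R a *\<^sub>R u" by simp
      also have "\<dots> = v" unfolding eq using \<open>b \<noteq> 0\<close> by simp
      finally have "v = (a / b) *\<^sub>R u" by (rule sym)
      then show False using nc unfolding collinear_lemma by blast
    qed
    have "u \<noteq> 0" using nc by (auto simp: collinear_lemma)
    then show "a = 0 \<and> b = 0" using b eq by simp
  qed
next
  assume ind: "\<forall>a b. a *\<^sub>R u = b *\<^sub>R v \<longrightarrow> a = 0 \<and> b = 0"
  show "\<not> collinear {0, u, v}"
  proof
    assume "collinear {0, u, v}"
    then consider "u = 0" | "v = 0" | c where "v = c *\<^sub>R u" unfolding collinear_lemma by blast
    then show False
    proof cases
      case 1 then show False using ind[rule_format, of 1 0] by simp
    next
      case 2 then show False using ind[rule_format, of 0 1] by simp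
    next
      case 3 then show False using ind[rule_format, of c 1] by simp
    qed
  qed
qed

lemma noncollinear_0_basis:
  fixes u v w :: "real^2"
  assumes "\<not> collinear {0, u, v}"
  obtains c d where "w = c *\<^sub>R u + d *\<^sub>R v"
proof -
  define f :: "real^2 \<Rightarrow> real^2" where "f x = (x $ 1) *\<^sub>R u + (x $ 2) *\<^sub>R v" for x
  have lin: "linear f"
    by (rule linearI) (simp_all add: f_def algebra_simps)
  have "x = 0" if "f x = 0" for x
  proof -
    have "(x $ 1) *\<^sub>R u = (- (x $ 2)) *\<^sub>R v"
      using that by (simp add: f_def eq_neg_iff_add_eq_0)
    then have "x $ 1 = 0 \<and> - (x $ 2) = 0"
      using assms unfolding noncollinear_0_iff by blast
    then show "x = 0" by (simp add: vec_eq_iff forall_2)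
  qed
  then have "surj f"
    using lin by (simp add: linear_injective_0 linear_injective_imp_surjective)
  then obtain x where "w = f x" by (metis surjD)
  then show thesis using that by (simp add: f_def)
qed

text \<open>A line is handled through one of its points and a direction vector \<open>u\<close>, as \<open>line S (S + u)\<close>.\<close>

lemma mem_line_direction_iff: "X \<in> line S (S + u) \<longleftrightarrow> (\<exists>t. X = S + t *\<^sub>R u)"
  by (auto simp: line_alt)

lemma line_direction_Int:
  assumes nc: "\<not> collinear {0, u, v}"
    and X: "X \<in> line S (S + u)" "X \<in> line T (T + v)"
  shows "line S (S + u) \<inter> line T (T + v) = {X}"
proof -
  obtain s t where st: "X = S + s *\<^sub>R u" "X = T + t *\<^sub>R v"
    using X unfolding mem_line_direction_iff by blast
  have "Y = X" if Y': "Y \<in> line S (S + u)" "Y \<in> line T (T + v)" for Y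
  proof -
    obtain a b where Y: "Y = S + a *\<^sub>R u" "Y = T + b *\<^sub>R v"
      using Y' unfolding mem_line_direction_iff by blast
    have "(a - s) *\<^sub>R u = Y - X" using Y(1) st(1) by (simp add: scaleR_left_diff_distrib)
    moreover have "(b - t) *\<^sub>R v = Y - X" using Y(2) st(2) by (simp add: scaleR_left_diff_distrib)
    ultimately have "a - s = 0"
      using nc unfolding noncollinear_0_iff by metis
    then show "Y = X" using Y(1) st(1) by simp
  qed
  then show ?thesis using X by blast
qed

lemma parallel_line_direction:
  assumes "c \<noteq> 0"
  shows "parallel (line S (S + u)) (line T (T + c *\<^sub>R u))"
proof (cases "line S (S + u) \<inter> line T (T + c *\<^sub>R u) = {}")
  case False
  then obtain s t where "S + s *\<^sub>R u = T + t *\<^sub>R c *\<^sub>R u"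
    by (auto simp: mem_line_direction_iff)
  then have S: "S = T + (t * c - s) *\<^sub>R u"
    by (simp add: algebra_simps)
  have "S + x *\<^sub>R u = T + ((x + (t * c - s)) / c) *\<^sub>R c *\<^sub>R u" for x
    using assms by (simp add: S scaleR_left_distrib)
  moreover have "T + x *\<^sub>R c *\<^sub>R u = S + (x * c - (t * c - s)) *\<^sub>R u" for x
    by (simp add: S algebra_simps)
  ultimately have "line S (S + u) = line T (T + c *\<^sub>R u)"
    unfolding set_eq_iff mem_line_direction_iff by metis
  then show ?thesis by (simp add: parallel_def)
qed (simp add: parallel_def)

lemma parallel_through_line:
  assumes "P \<noteq> Q"
  shows "parallel_through R (line P Q) = line R (R + (Q - P))"
  unfolding parallel_through_def
proof (rule the1_equality)
  show "\<exists>!n. is_line n \<and> R \<in> n \<and> parallel n (line P Q)"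
    by (rule ex1_parallel_through) (use assms in \<open>auto simp: is_line_def\<close>)
  have "is_line (line R (R + (Q - P)))"
    unfolding is_line_def by (rule exI[of _ R], rule exI[of _ "R + (Q - P)"]) (use assms in simp)
  moreover have "R \<in> line R (R + (Q - P))"
    unfolding mem_line_direction_iff by (rule exI[of _ 0]) simp
  moreover have "parallel (line R (R + (Q - P))) (line P Q)"
    using parallel_line_direction[of 1 R "Q - P" P] by simp
  ultimately show "is_line (line R (R + (Q - P))) \<and> R \<in> line R (R + (Q - P)) \<and>
      parallel (line R (R + (Q - P))) (line P Q)" by blast
qed

lemma noncollinear_directions_if_not_parallel:
  assumes "\<not> parallel (line P Q) (line P' Q')" "P \<noteq> Q" "P' \<noteq> Q'"
  shows "\<not> collinear {0, Q - P, Q' - P'}"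
proof
  assume "collinear {0, Q - P, Q' - P'}"
  then obtain c where c: "Q' - P' = c *\<^sub>R (Q - P)"
    using assms(2,3) by (auto simp: collinear_lemma)
  then have "c \<noteq> 0" using assms(3) by auto
  then have "parallel (line P (P + (Q - P))) (line P' (P' + (Q' - P')))"
    unfolding c by (rule parallel_line_direction)
  then show False using assms(1) by simp
qed

section \<open>Non-isometric similarities as affine maps\<close>

text \<open>
  A distance-scaling map fixing the origin is linear. The ratio differs from \<open>1\<close>, so \<open>A\<close> moves every
  nonzero vector; in finite dimension the injective map \<open>A - id\<close> is then onto, and solving
  \<open>A C - C = - \<alpha> 0\<close> yields the fixed point.
\<close>

lemma non_isometric_similarity_affine:
  assumes "non_isometric_similarity \<alpha>"
  obtains A C where "linear A" "inj A" "bij (\<lambda>X. A X - X)"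
    "\<forall>X. \<alpha> X = C + A (X - C)" "{X. \<alpha> X = X} = {C}"
proof -
  obtain r where r: "r \<noteq> 1" "r > 0" "\<And>P Q. dist (\<alpha> P) (\<alpha> Q) = r * dist P Q"
    using assms by (auto simp: non_isometric_similarity_def similarity_def)
  define A where "A X = \<alpha> X - \<alpha> 0" for X
  have lin: "linear A"
    by (rule scaling_linear[of _ r]) (use r(3) in \<open>auto simp: A_def dist_norm\<close>)
  have norm: "norm (A X) = r * norm X" for X
    using r(3)[of X 0] by (simp add: A_def dist_norm)
  have inj: "inj A"
    unfolding linear_injective_0[OF lin] using norm r(2) by (metis mult_eq_0_iff norm_eq_zero less_irrefl)
  have lin': "linear (\<lambda>X. A X - X)"
    by (intro linear_compose_sub lin linear_ident)
  have "X = 0" if "A X - X = 0" for X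
    using norm[of X] that r(1) by simp
  then have inj': "inj (\<lambda>X. A X - X)"
    using linear_injective_0[OF lin'] by blast
  then have bij: "bij (\<lambda>X. A X - X)"
    using lin' by (simp add: bij_def linear_injective_imp_surjective)
  obtain C where C: "A C - C = - \<alpha> 0"
    using surjD[OF bij_is_surj[OF bij], of "- \<alpha> 0"] by auto
  have \<alpha>: "\<alpha> X = C + A (X - C)" for X
  proof -
    have "C + A (X - C) = A X - (A C - C)" by (simp add: linear_diff[OF lin])
    also have "\<dots> = \<alpha> X" unfolding C by (simp add: A_def)
    finally show ?thesis by simp
  qed
  have "X = C" if "\<alpha> X = X" for X
  proof -
    have "A (X - C) - (X - C) = A 0 - 0"
      using that \<alpha>[of X] by (simp add: linear_0[OF lin] algebra_simps)
    then have "X - C = 0" using inj' by (meson injD)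
    then show "X = C" by simp
  qed
  moreover have "\<alpha> C = C"
    using C by (simp add: A_def)
  ultimately have "{X. \<alpha> X = X} = {C}" by blast
  then show thesis by (rule that[OF lin inj bij allI[OF \<alpha>]])
qed

section \<open>Lines meeting their images\<close>

text \<open>
  The coefficient \<open>c\<close> identifies the line within its parallel class, and as \<open>c\<close> varies the meeting
  point moves along the line through \<open>C\<close> of direction \<open>A U\<close>.
\<close>

lemma line_Int_image_line:
  assumes lin: "linear A" and \<alpha>: "\<And>X. \<alpha> X = C + A (X - C)"
    and U: "A U = U + u" and nc: "\<not> collinear {0, u, A u}"
    and S: "S = C + (c *\<^sub>R U + d *\<^sub>R u)"
  shows "line S (S + u) \<inter> line (\<alpha> S) (\<alpha> S + A u) = {C + c *\<^sub>R A U}"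
proof (rule line_direction_Int[OF nc])
  have "C + c *\<^sub>R A U = S + (c - d) *\<^sub>R u"
    by (simp add: S U algebra_simps)
  then show "C + c *\<^sub>R A U \<in> line S (S + u)"
    unfolding mem_line_direction_iff by blast
  have "\<alpha> S = C + (c *\<^sub>R A U + d *\<^sub>R A u)"
    by (simp add: \<alpha> S linear_add[OF lin] linear_scale[OF lin])
  then have "C + c *\<^sub>R A U = \<alpha> S + (- d) *\<^sub>R A u"
    by simp
  then show "C + c *\<^sub>R A U \<in> line (\<alpha> S) (\<alpha> S + A u)"
    unfolding mem_line_direction_iff by blast
qed

text \<open>
  Steps (1)--(4) for the side \<open>S T\<close> and the opposite vertex \<open>W\<close>. The points \<open>D\<close> and \<open>E\<close> are
  distinct because \<open>W\<close> is not on \<open>S T\<close>, so that the two parallel lines have different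
  coefficients \<open>c\<close>, and \<open>A U \<noteq> 0\<close>.
\<close>

lemma construction_line:
  assumes lin: "linear A" and inj: "inj A" and \<alpha>: "\<And>X. \<alpha> X = C + A (X - C)"
    and U: "A U = U + (T - S)"
    and tri: "\<not> collinear {S, T, W}"
    and np: "\<not> parallel (line S T) (line (\<alpha> S) (\<alpha> T))"
  shows "\<exists>D E. line S T \<inter> line (\<alpha> S) (\<alpha> T) = {D} \<and>
      parallel_through W (line S T) \<inter> parallel_through (\<alpha> W) (line (\<alpha> S) (\<alpha> T)) = {E} \<and>
      D \<noteq> E \<and> line D E = line C (C + A U)"
proof -
  define u where "u = T - S"
  have ST: "S \<noteq> T" using tri by auto
  then have u: "u \<noteq> 0" by (simp add: u_def)
  have Au: "\<alpha> T - \<alpha> S = A u"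
    by (simp add: \<alpha> u_def flip: linear_diff[OF lin])
  have \<alpha>ST: "\<alpha> S \<noteq> \<alpha> T"
    using inj ST by (simp add: \<alpha> inj_eq)
  have nc: "\<not> collinear {0, u, A u}"
    using noncollinear_directions_if_not_parallel[OF np ST \<alpha>ST] by (simp add: u_def Au[unfolded u_def])
  have U': "A U = U + u" using U by (simp add: u_def)
  have AU: "A U \<noteq> 0"
  proof
    assume "A U = 0"
    then have "U = 0" using inj lin by (simp add: linear_injective_0)
    then show False using U' u linear_0[OF lin] by simp
  qed
  have ncU: "\<not> collinear {0, U, u}"
    unfolding noncollinear_0_iff
  proof (intro allI impI)
    fix a b assume ab: "a *\<^sub>R U = b *\<^sub>R u"
    \<comment> \<open>If \<open>U\<close> were parallel to \<open>u\<close>, then so would be \<open>A U = U + u\<close>; but \<open>A U\<close> would also be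
      parallel to \<open>A u\<close>, which is independent of \<open>u\<close>.\<close>
    have "b *\<^sub>R A u = a *\<^sub>R A U"
      by (metis ab lin linear_scale)
    also have "\<dots> = (a + b) *\<^sub>R u"
      by (simp add: U' ab algebra_simps)
    finally have "(a + b) *\<^sub>R u = b *\<^sub>R A u" by simp
    then have "a + b = 0 \<and> b = 0" using nc unfolding noncollinear_0_iff by blast
    then show "a = 0 \<and> b = 0" by simp
  qed
  obtain c d where cd: "S - C = c *\<^sub>R U + d *\<^sub>R u" using noncollinear_0_basis[OF ncU] .
  obtain e f where ef: "W - C = e *\<^sub>R U + f *\<^sub>R u" using noncollinear_0_basis[OF ncU] .
  have S: "S = C + (c *\<^sub>R U + d *\<^sub>R u)" using cd by (metis add_diff_cancel_left' diff_add_cancel add.commute)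
  have W: "W = C + (e *\<^sub>R U + f *\<^sub>R u)" using ef by (metis add_diff_cancel_left' diff_add_cancel add.commute)
  have ce: "c \<noteq> e"
  proof
    assume "c = e"
    then have "W - S = (f - d) *\<^sub>R (T - S)"
      unfolding u_def[symmetric] using cd ef by (simp add: algebra_simps)
    then have "collinear {0, T - S, W - S}" unfolding collinear_lemma by blast
    then have "collinear {T, S, W}" using collinear_3[of T S W] by simp
    then show False using tri by (simp add: insert_commute)
  qed
  let ?D = "C + c *\<^sub>R A U" and ?E = "C + e *\<^sub>R A U"
  have "line S T \<inter> line (\<alpha> S) (\<alpha> T) = {?D}"
    using line_Int_image_line[OF lin \<alpha> U' nc S] by (simp add: u_def Au[symmetric, unfolded u_def])
  moreover have "parallel_through W (line S T) \<inter> parallel_through (\<alpha> W) (line (\<alpha> S) (\<alpha> T)) = {?E}"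
    using line_Int_image_line[OF lin \<alpha> U' nc W]
    by (simp add: parallel_through_line ST \<alpha>ST Au flip: u_def)
  moreover have "?D \<noteq> ?E"
    using ce AU by simp
  moreover have "line ?D ?E = line C (C + A U)"
  proof -
    have E: "?E = ?D + (e - c) *\<^sub>R A U" by (simp add: algebra_simps)
    have "parallel (line C (C + A U)) (line ?D ?E)"
      unfolding E by (rule parallel_line_direction) (use ce in simp)
    moreover have "?D \<in> line C (C + A U)" unfolding mem_line_direction_iff by blast
    moreover have "?D \<in> line ?D ?E" by (simp add: line_def hull_inc)
    ultimately show ?thesis by (auto simp: parallel_def)
  qed
  ultimately show ?thesis by blast
qed

section \<open>Constructing the fixed point\<close>

theorem theorem2:
  fixes \<alpha> :: "real^2 \<Rightarrow> real^2"
    and P Q R P' Q' R' :: "real^2"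
    and m n m' n' k l k' l' :: "(real^2) set"
  assumes "non_isometric_similarity \<alpha>"
    and "\<not> dilation \<alpha>"
    and "\<not> collinear {P, Q, R}"
    and "P' = \<alpha> P" and "Q' = \<alpha> Q" and "R' = \<alpha> R"
    and "\<not> collinear {P', Q', R'}"
    and "\<not> parallel (line P Q) (line P' Q')"
    and "\<not> parallel (line Q R) (line Q' R')"
    and "m = line P Q" and "n = parallel_through R m"
    and "m' = line P' Q'" and "n' = parallel_through R' m'"
    and "k = line Q R" and "l = parallel_through P k"
    and "k' = line Q' R'" and "l' = parallel_through P' k'"
  shows "\<exists>D E F G C.
      m \<inter> m' = {D} \<and> n \<inter> n' = {E} \<and> D \<noteq> E \<and>
      k \<inter> k' = {F} \<and> l \<inter> l' = {G} \<and> F \<noteq> G \<and>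
      line D E \<inter> line F G = {C} \<and>
      {X. \<alpha> X = X} = {C}"
proof -
  obtain A C where A: "linear A" "inj A" "bij (\<lambda>X. A X - X)"
    and \<alpha>_all: "\<forall>X. \<alpha> X = C + A (X - C)" and fix_C: "{X. \<alpha> X = X} = {C}"
    using non_isometric_similarity_affine[OF assms(1)] .
  note \<alpha> = \<alpha>_all[rule_format]
  obtain U where "A U - U = Q - P"
    using surjD[OF bij_is_surj[OF A(3)], of "Q - P"] by auto
  then have U: "A U = U + (Q - P)" by (simp add: diff_eq_eq add.commute)
  obtain V where "A V - V = R - Q"
    using surjD[OF bij_is_surj[OF A(3)], of "R - Q"] by auto
  then have V: "A V = V + (R - Q)" by (simp add: diff_eq_eq add.commute)
  have tri: "\<not> collinear {Q, R, P}" using assms(3) by (simp add: insert_commute)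
  obtain D E where DE: "m \<inter> m' = {D}" "n \<inter> n' = {E}" "D \<noteq> E"
      and a: "line D E = line C (C + A U)"
    using construction_line[OF A(1,2) \<alpha> U assms(3) assms(8)[unfolded assms(4,5)]]
    unfolding assms(4-6,10-13) by blast
  obtain F G where FG: "k \<inter> k' = {F}" "l \<inter> l' = {G}" "F \<noteq> G"
      and b: "line F G = line C (C + A V)"
    using construction_line[OF A(1,2) \<alpha> V tri assms(9)[unfolded assms(5,6)]]
    unfolding assms(4-6,14-17) by blast
  have ind: "\<not> collinear {0, P - Q, R - Q}"
    using assms(3) collinear_3[of P Q R] by (simp add: NO_MATCH_def)
  have "\<not> collinear {0, A U, A V}"
    unfolding noncollinear_0_iff
  proof (intro allI impI)
    fix s t assume "s *\<^sub>R A U = t *\<^sub>R A V"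
    moreover from this have "s *\<^sub>R U = t *\<^sub>R V"
      using A(2) by (simp add: inj_eq flip: linear_scale[OF A(1)])
    ultimately have "(- s) *\<^sub>R (P - Q) = t *\<^sub>R (R - Q)"
      by (simp add: U V algebra_simps)
    then have "- s = 0 \<and> t = 0" using ind unfolding noncollinear_0_iff by blast
    then show "s = 0 \<and> t = 0" by simp
  qed
  then have "line D E \<inter> line F G = {C}"
    unfolding a b by (rule line_direction_Int) (simp_all add: line_def hull_inc)
  with DE FG fix_C show ?thesis
    by (intro exI conjI)
qed

end
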